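(* Let $\alpha>0$, $\lambda\in\mathbb{R}$, let $r\ge 0$ be an integer, and let $X_{\lambda,r}$ be the $r$-truncated degenerate Poisson random variable with parameter $\alpha$. For every real $x\ge r+1$, the cumulative distribution function $F_{X_{\lambda,r}}(x)=P\{X_{\lambda,r}\le x\}$ of $X_{\lambda,r}$ is given by $$F_{X_{\lambda,r}}(x)=\frac{1}{e_{\lambda}(\alpha)-e_{\lambda,r}(\alpha)}\bigl(e_{\lambda,[x]}(\alpha)-e_{\lambda,r}(\alpha)\bigr),$$ where $[x]$ denotes the greatest integer not exceeding $x$.
   Context: For $\lambda,x\in\mathbb{R}$ put $(x)_{0,\lambda}=1$ and $(x)_{n,\lambda}=x(x-\lambda)(x-2\lambda)\cdots(x-(n-1)\lambda)$ for $n\ge 1$. The degenerate exponential function is $e_{\lambda}(t)=(1+\lambda t)^{1/\lambda}=\sum_{k=0}^{\infty}(1)_{k,\lambda}\frac{t^k}{k!}$ (for $\lambda=0$, $e_0(t)=e^t$), and for any integer $s\ge 0$, $e_{\lambda,s}(t)=\sum_{k=0}^{s}(1)_{k,\lambda}\frac{t^k}{k!}$. The $r$-truncated degenerate Poisson random variable with parameter $\alpha>0$ is the random variable $X_{\lambda,r}$ taking values in $\{r+1,r+2,\dots\}$ with probability mass function $$p_{\lambda,r}(k)=P\{X_{\lambda,r}=k\}=\frac{(1)_{k,\lambda}}{e_{\lambda}(\alpha)-e_{\lambda,r}(\alpha)}\,\frac{\alpha^k}{k!},\qquad k=r+1,r+2,\dots.$$ To say that $X_{\lambda,r}$ is such a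 random variable presupposes that $\lambda,\alpha,r$ are such that this is a probability mass function: the series $\sum_k (1)_{k,\lambda}\alpha^k/k!$ converges to $e_\lambda(\alpha)$, the denominator $e_{\lambda}(\alpha)-e_{\lambda,r}(\alpha)$ is nonzero, and all values $p_{\lambda,r}(k)$ are nonnegative (so that they sum to $1$). *)

theory Defs
  imports "HOL-Probability.Probability"
begin

definition deg_falling :: "real \<Rightarrow> real \<Rightarrow> nat \<Rightarrow> real" where
  "deg_falling lam x n = (\<Prod>i<n. x - real i * lam)"

(* If 1 + lam * t \<le> 0, the value of powr is only a convention of the library.
   For t > 0 this needs lam * t \<le> -1, where the series below diverges, so the
   case is excluded by the convergence condition in trunc_deg_poisson_params. *)
definition deg_exp :: "real \<Rightarrow> real \<Rightarrow> real" where
  "deg_exp lam t = (if lam = 0 then exp t else (1 + lam * t) powr (1 / lam))"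

definition deg_exp_trunc :: "real \<Rightarrow> nat \<Rightarrow> real \<Rightarrow> real" where
  "deg_exp_trunc lam s t = (\<Sum>k\<le>s. deg_falling lam 1 k * t ^ k / fact k)"

definition trunc_deg_poisson_mass :: "real \<Rightarrow> nat \<Rightarrow> real \<Rightarrow> nat \<Rightarrow> real" where
  "trunc_deg_poisson_mass lam r \<alpha> k =
     deg_falling lam 1 k / (deg_exp lam \<alpha> - deg_exp_trunc lam r \<alpha>) * (\<alpha> ^ k / fact k)"

(* The parameters for which the mass function really is a probability mass function. *)
definition trunc_deg_poisson_params :: "real \<Rightarrow> nat \<Rightarrow> real \<Rightarrow> bool" where
  "trunc_deg_poisson_params lam r \<alpha> \<longleftrightarrow>
     (\<lambda>k. deg_falling lam 1 k * \<alpha> ^ k / fact k) sums deg_exp lam \<alpha> \<and>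
     deg_exp lam \<alpha> - deg_exp_trunc lam r \<alpha> \<noteq> 0 \<and>
     (\<forall>k\<ge>r + 1. trunc_deg_poisson_mass lam r \<alpha> k \<ge> 0)"

definition trunc_deg_poisson_rv ::
  "'a measure \<Rightarrow> real \<Rightarrow> nat \<Rightarrow> real \<Rightarrow> ('a \<Rightarrow> real) \<Rightarrow> bool" where
  "trunc_deg_poisson_rv M lam r \<alpha> X \<longleftrightarrow>
     trunc_deg_poisson_params lam r \<alpha> \<and>
     X \<in> borel_measurable M \<and>
     (\<forall>\<omega>\<in>space M. X \<omega> \<in> real ` {r + 1..}) \<and>
     (\<forall>k\<ge>r + 1. measure M {\<omega> \<in> space M. X \<omega> = real k} = trunc_deg_poisson_mass lam r \<alpha> k)"

end

theory Submission
  imports Defs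
begin

text \<open>Since \<open>X\<close> takes only integer values above \<open>r\<close>, the event that
  \<open>X\<close> is at most \<open>x\<close> splits into the finitely many disjoint atoms
  \<open>X = k\<close> with \<open>r < k\<close> and \<open>k\<close> at most the floor of
  \<open>x\<close>. Finite additivity turns its probability into a sum of masses; with the common
  normalising factor pulled out, what remains is a block of consecutive terms of the series of
  \<open>deg_exp\<close>, that is, a difference of two partial sums.\<close>

theorem theorem4:
  fixes M :: "'a measure" and X :: "'a \<Rightarrow> real"
    and \<alpha> lam x :: real and r :: nat
  assumes "prob_space M"
    and "\<alpha> > 0"
    and "trunc_deg_poisson_rv M lam r \<alpha> X"
    and "x \<ge> real r + 1"
  shows "cdf (distr M borel X) x =
    1 / (deg_exp lam \<alpha> - deg_exp_trunc lam r \<alpha>) *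
      (deg_exp_trunc lam (nat \<lfloor>x\<rfloor>) \<alpha> - deg_exp_trunc lam r \<alpha>)"
proof -
  interpret prob_space M by fact
  define n where "n = nat \<lfloor>x\<rfloor>"
  define d where "d = deg_exp lam \<alpha> - deg_exp_trunc lam r \<alpha>"
  define A where "A k = {\<omega> \<in> space M. X \<omega> = real k}" for k
  from assms(3) have X [measurable]: "X \<in> borel_measurable M"
    and range_X: "\<And>\<omega>. \<omega> \<in> space M \<Longrightarrow> X \<omega> \<in> real ` {r + 1..}"
    and prob_A: "\<And>k. k \<ge> r + 1 \<Longrightarrow> prob (A k) = trunc_deg_poisson_mass lam r \<alpha> k"
    by (auto simp: trunc_deg_poisson_rv_def A_def)
  \<comment> \<open>Here \<open>x\<close> must be nonnegative: for negative \<open>x\<close>,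
    \<open>nat\<close> would send the floor to 0 and the equivalence would fail at
    \<open>k = 0\<close>.\<close>
  have le_x_iff: "real k \<le> x \<longleftrightarrow> k \<le> n" for k
    using assms(4) by (simp add: n_def le_nat_floor le_nat_iff le_floor_iff)
  have "r \<le> n"
    using le_x_iff[of r] assms(4) by simp
  have "cdf (distr M borel X) x = prob (X -` {..x} \<inter> space M)"
    by (simp add: cdf_def measure_distr)
  also have "X -` {..x} \<inter> space M = (\<Union>k\<in>{r<..n}. A k)"
    using range_X by (fastforce simp: A_def le_x_iff)
  also have "prob \<dots> = (\<Sum>k\<in>{r<..n}. prob (A k))"
    by (intro finite_measure_finite_Union) (auto simp: A_def disjoint_family_on_def)
  also have "\<dots> = (\<Sum>k\<in>{r<..n}. 1 / d * (deg_falling lam 1 k * \<alpha> ^ k / fact k))"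
    by (intro sum.cong) (auto simp: prob_A trunc_deg_poisson_mass_def d_def)
  \<comment> \<open>The interval is written as a set difference so that \<open>sum_diff\<close> can
    split the sum; its inclusion condition is \<open>r \<le> n\<close>.\<close>
  also have "\<dots> = 1 / d * (\<Sum>k\<in>{..n} - {..r}. deg_falling lam 1 k * \<alpha> ^ k / fact k)"
    unfolding sum_distrib_left by (intro sum.cong) auto
  also have "\<dots> = 1 / d * (deg_exp_trunc lam n \<alpha> - deg_exp_trunc lam r \<alpha>)"
    using \<open>r \<le> n\<close> by (subst sum_diff) (auto simp: deg_exp_trunc_def)
  finally show ?thesis
    by (simp only: n_def d_def)
qed

end
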